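(* a) Let $A$ be a generic Druzkowski matrix of dimension $n$. Then there are no $k\in\{3,\ldots,n\}$ and $y\in\mathbb{C}^n$ such that $$Z_k+A.(Z_k^3+Z_k*(A.y)^2)=0,$$ and there are no $k\in\{3,\ldots,n\}$ and $y\in\mathbb{C}^n$ such that $$\det(Id+\Delta[(sZ_k+ty)^2].A)=1\ \ \forall s,t\in\mathbb{C},\qquad Z_k+A.(Z_k^3+Z_k*y^2)=0.$$ b) More generally, let $V$ be an algebraic subvariety of $\mathcal{M}_n$ invariant under the action of the group of invertible diagonal matrices, i.e. $DVD^{-3}=V$ for every invertible diagonal matrix $D$. Let $A$ be a generic element of $V$. Then there are no $k\in\{3,\ldots,n\}$ and $y\in\mathbb{C}^n$ such that $$\det(Id+\Delta[(sZ_k+tA.y)^2].A)=1\ \ \forall s,t\in\mathbb{C},\qquad Z_k+A.(Z_k^3+Z_k*(A.y)^2)=0,$$ and there are no $k\in\{3,\ldots,n\}$ and $y\in\mathbb{C}^n$ such that $$\det(Id+\Delta[(sZ_k+ty)^2].A)=1\ \ \forall s,t\in\mathbb{C},\qquad Z_k+A.(Z_k^3+Z_k*y^2)=0.$$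
   Context: $\mathcal{M}_n$ is the set of complex $n\times n$ matrices. For $u,v\in\mathbb{C}^n$, $u*v=(u_1v_1,\ldots,u_nv_n)$ is the coordinatewise product, $u^k$ is the coordinatewise $k$-th power, and $\Delta[u]$ is the diagonal $n\times n$ matrix with $(i,i)$ entry $u_i$. $Z_k=(1,\ldots,1,0,\ldots,0)^t\in\mathbb{C}^n$ is the vector whose first $k$ coordinates are $1$ and whose last $n-k$ coordinates are $0$. A matrix $A\in\mathcal{M}_n$ is called Druzkowski if the map $F_A(x)=x+(A.x)^3:\mathbb{C}^n\to\mathbb{C}^n$ has Jacobian determinant identically equal to $1$; the Druzkowski $n\times n$ matrices form an algebraic subvariety of $\mathcal{M}_n$. Here "a generic element of an algebraic variety $X$ has property $P$" means that there is a proper subvariety of $X$, containing no irreducible component of $X$, such that every element of $X$ outside it has property $P$. *)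

theory Defs
  imports "HOL-Analysis.Analysis"
begin

text \<open>
  Vectors in \<open>\<complex>\<^sup>n\<close> and complex \<open>n \<times> n\<close> matrices are indexed by a finite linearly ordered type
  \<open>'n\<close> with \<open>n = CARD('n)\<close>; the order is only used to say which coordinates are the first \<open>k\<close>.
  On \<open>complex ^ 'n\<close> the library operations \<open>*\<close> and \<open>^\<close> are the coordinatewise product and power.
  They are coordinatewise on matrices too, so the matrix product is always written \<open>**\<close> and
  the identity matrix \<open>mat 1\<close>.
\<close>

type_synonym 'n cvec = "complex ^ 'n"
type_synonym 'n cmat = "complex ^ 'n ^ 'n"

definition diag_matrix :: "'n::finite cvec \<Rightarrow> 'n cmat" (\<open>\<Delta>[_]\<close>) where
  "\<Delta>[u] = (\<chi> i j. if i = j then u $ i else 0)"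

text \<open>The coordinate \<open>i\<close> is among the first \<open>k\<close> iff fewer than \<open>k\<close> indices precede it.\<close>

definition Zvec :: "nat \<Rightarrow> ('n::{finite,linorder}) cvec" where
  "Zvec k = (\<chi> i. if card {j. j < i} < k then 1 else 0)"

text \<open>Entry \<open>(i, j)\<close> is the complex partial derivative of the \<open>i\<close>-th component of \<open>F\<close> in the
  \<open>j\<close>-th variable.\<close>

definition complex_jacobian :: "('n::finite cvec \<Rightarrow> 'n cvec) \<Rightarrow> 'n cvec \<Rightarrow> 'n cmat" where
  "complex_jacobian F x = (\<chi> i j. deriv (\<lambda>z. F (x + z *s axis j 1) $ i) 0)"

definition druzkowski_map :: "'n::finite cmat \<Rightarrow> 'n cvec \<Rightarrow> 'n cvec" where
  "druzkowski_map A x = x + (A *v x) ^ 3"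

definition druzkowski_matrices :: "'n::finite cmat set" where
  "druzkowski_matrices = {A. \<forall>x. det (complex_jacobian (druzkowski_map A) x) = 1}"

text \<open>Complex polynomial functions in the matrix entries.\<close>

inductive polynomial_in_entries :: "('n::finite cmat \<Rightarrow> complex) \<Rightarrow> bool" where
  const: "polynomial_in_entries (\<lambda>A. c)"
| entry: "polynomial_in_entries (\<lambda>A. A $ i $ j)"
| add: "polynomial_in_entries p \<Longrightarrow> polynomial_in_entries q \<Longrightarrow> polynomial_in_entries (\<lambda>A. p A + q A)"
| mult: "polynomial_in_entries p \<Longrightarrow> polynomial_in_entries q \<Longrightarrow> polynomial_in_entries (\<lambda>A. p A * q A)"

definition algebraic_subvariety :: "'n::finite cmat set \<Rightarrow> bool" where
  "algebraic_subvariety V \<longleftrightarrow>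
    (\<exists>S. (\<forall>p\<in>S. polynomial_in_entries p) \<and> V = {A. \<forall>p\<in>S. p A = 0})"

definition irreducible_variety :: "'n::finite cmat set \<Rightarrow> bool" where
  "irreducible_variety W \<longleftrightarrow> algebraic_subvariety W \<and> W \<noteq> {} \<and>
    (\<forall>W1 W2. algebraic_subvariety W1 \<and> algebraic_subvariety W2 \<and> W = W1 \<union> W2 \<longrightarrow>
      W = W1 \<or> W = W2)"

definition irreducible_component :: "'n::finite cmat set \<Rightarrow> 'n cmat set \<Rightarrow> bool" where
  "irreducible_component W X \<longleftrightarrow> irreducible_variety W \<and> W \<subseteq> X \<and>
    (\<forall>W'. irreducible_variety W' \<and> W \<subseteq> W' \<and> W' \<subseteq> X \<longrightarrow> W' = W)"

definition generically :: "'n::finite cmat set \<Rightarrow> ('n cmat \<Rightarrow> bool) \<Rightarrow> bool" where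
  "generically X P \<longleftrightarrow>
    (\<exists>Y. algebraic_subvariety Y \<and> Y \<subset> X \<and>
      (\<forall>W. irreducible_component W X \<longrightarrow> \<not> W \<subseteq> Y) \<and>
      (\<forall>A\<in>X - Y. P A))"

text \<open>Invariance under the action \<open>A \<mapsto> D A D\<^sup>-\<^sup>3\<close> of the invertible diagonal matrices \<open>D\<close>.\<close>

definition diagonal_invariant :: "'n::finite cmat set \<Rightarrow> bool" where
  "diagonal_invariant V \<longleftrightarrow>
    (\<forall>d. let D = \<Delta>[d] in
      invertible D \<longrightarrow> (\<lambda>A. D ** A ** matrix_inv (D ** D ** D)) ` V = V)"

end

theory Submission
  imports Defs "HOL-Complex_Analysis.Conformal_Mappings" "HOL-Library.Function_Algebras"
begin

text \<open>
  All the forbidden conditions imply that \<open>det (1 + \<Delta>[Z] A) = 1\<close> and that \<open>Z + A (Z * u) = 0\<close> has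
  a solution \<open>u\<close>, where \<open>Z = Z\<^sub>k\<close>: take \<open>s = 1\<close> and \<open>t = 0\<close> in the pencil or, for a Druzkowski
  matrix, use that \<open>Z\<close> lies in the image of \<open>A\<close>. Let \<open>N\<close> be the hypersurface
  \<open>det (1 + \<Delta>[Z] A) = 1\<close>. By Hilbert's basis theorem \<open>V\<close> is a finite union of irreducible
  components, and each component \<open>C\<close> is invariant under the connected torus. If \<open>C \<subseteq> N\<close>, then
  \<open>det (1 + \<Delta>[Z] D A D\<^sup>-\<^sup>3) = 1\<close> for all \<open>A \<in> C\<close> and all \<open>D\<close>, and this makes \<open>Z + A (Z * u) = 0\<close>
  unsolvable. So the exceptional set can be taken to be the union of \<open>C \<inter> N\<close> over the components
  \<open>C\<close> not contained in \<open>N\<close>.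
\<close>


section \<open>Hilbert's basis theorem\<close>

text \<open>Rings are subsets of one ambient ring, so the type stays fixed while elements are
  adjoined one after another.\<close>

definition subring_set :: "'a::comm_ring_1 set \<Rightarrow> bool" where
  "subring_set R \<longleftrightarrow> 1 \<in> R \<and> -1 \<in> R \<and> (\<forall>a\<in>R. \<forall>b\<in>R. a + b \<in> R \<and> a * b \<in> R)"

definition ideal_in :: "'a::comm_ring_1 set \<Rightarrow> 'a set \<Rightarrow> bool" where
  "ideal_in R J \<longleftrightarrow> J \<subseteq> R \<and> 0 \<in> J \<and> (\<forall>a\<in>J. \<forall>b\<in>J. a + b \<in> J) \<and> (\<forall>r\<in>R. \<forall>a\<in>J. r * a \<in> J)"

definition ideal_acc :: "'a::comm_ring_1 set \<Rightarrow> bool" where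
  "ideal_acc R \<longleftrightarrow>
    (\<forall>F :: nat \<Rightarrow> 'a set. (\<forall>n. ideal_in R (F n)) \<longrightarrow> incseq F \<longrightarrow> (\<exists>N. \<forall>n\<ge>N. F n = F N))"

text \<open>Values at \<open>x\<close> of polynomials over \<open>R\<close> of degree less than
  \<open>d\<close>. The strict bound makes what remains below a leading term of degree
  \<open>d\<close> a member at index \<open>d\<close>.\<close>

primrec poly_exprs :: "'a::comm_ring_1 set \<Rightarrow> 'a \<Rightarrow> nat \<Rightarrow> 'a set" where
  "poly_exprs R x 0 = {0}"
| "poly_exprs R x (Suc d) = {r * x ^ d + g |r g. r \<in> R \<and> g \<in> poly_exprs R x d}"

definition adjoin :: "'a::comm_ring_1 set \<Rightarrow> 'a \<Rightarrow> 'a set" where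
  "adjoin R x = (\<Union>d. poly_exprs R x d)"

text \<open>The expressions in \<open>x\<close> need not be unique, so these are the leading coefficients of all
  possible ways to write elements of \<open>J\<close>.\<close>

definition lead_coeffs :: "'a::comm_ring_1 set \<Rightarrow> 'a \<Rightarrow> 'a set \<Rightarrow> nat \<Rightarrow> 'a set" where
  "lead_coeffs R x J d = {r \<in> R. \<exists>g \<in> poly_exprs R x d. r * x ^ d + g \<in> J}"

lemma subring_setD:
  assumes "subring_set R"
  shows "1 \<in> R" "-1 \<in> R" "0 \<in> R" "a \<in> R \<Longrightarrow> b \<in> R \<Longrightarrow> a + b \<in> R"
    "a \<in> R \<Longrightarrow> b \<in> R \<Longrightarrow> a * b \<in> R" "a \<in> R \<Longrightarrow> - a \<in> R"
proof -
  show *: "1 \<in> R" "-1 \<in> R" "a \<in> R \<Longrightarrow> b \<in> R \<Longrightarrow> a + b \<in> R" "a \<in> R \<Longrightarrow> b \<in> R \<Longrightarrow> a * b \<in> R" for a b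
    using assms by (auto simp: subring_set_def)
  show "0 \<in> R" using *(3)[OF *(1,2)] by simp
  show "a \<in> R \<Longrightarrow> - a \<in> R" using *(4)[OF *(2)] by fastforce
qed

lemma ideal_inD:
  assumes "ideal_in R J"
  shows "J \<subseteq> R" "0 \<in> J" "a \<in> J \<Longrightarrow> b \<in> J \<Longrightarrow> a + b \<in> J" "r \<in> R \<Longrightarrow> a \<in> J \<Longrightarrow> r * a \<in> J"
  using assms by (auto simp: ideal_in_def)

context
  fixes R :: "'a::comm_ring_1 set" and x :: 'a
  assumes R: "subring_set R"
begin

lemma poly_exprs_SucI: "r \<in> R \<Longrightarrow> g \<in> poly_exprs R x d \<Longrightarrow> r * x ^ d + g \<in> poly_exprs R x (Suc d)"
  by auto

lemma poly_exprs_zero: "0 \<in> poly_exprs R x d"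
  by (induction d) (auto intro!: exI[of _ 0] simp: subring_setD[OF R])

lemma poly_exprs_add: "a \<in> poly_exprs R x d \<Longrightarrow> b \<in> poly_exprs R x d \<Longrightarrow> a + b \<in> poly_exprs R x d"
proof (induction d arbitrary: a b)
  case (Suc d)
  then obtain r g r' g' where "a = r * x ^ d + g" "b = r' * x ^ d + g'" "r \<in> R" "r' \<in> R"
    "g \<in> poly_exprs R x d" "g' \<in> poly_exprs R x d" by auto
  moreover from this have "a + b = (r + r') * x ^ d + (g + g')"
    by (simp add: algebra_simps)
  ultimately show ?case
    using poly_exprs_SucI[OF subring_setD(4)[OF R] Suc.IH] by (simp only:)
qed auto

lemma poly_exprs_scale: "r \<in> R \<Longrightarrow> a \<in> poly_exprs R x d \<Longrightarrow> r * a \<in> poly_exprs R x d"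
proof (induction d arbitrary: a)
  case (Suc d)
  then obtain s g where "a = s * x ^ d + g" "s \<in> R" "g \<in> poly_exprs R x d" by auto
  moreover from this have "r * a = (r * s) * x ^ d + r * g"
    by (simp add: algebra_simps)
  ultimately show ?case
    using poly_exprs_SucI[OF subring_setD(5)[OF R] Suc.IH] \<open>r \<in> R\<close> by (simp only:)
qed auto

lemma poly_exprs_shift: "a \<in> poly_exprs R x d \<Longrightarrow> x * a \<in> poly_exprs R x (Suc d)"
proof (induction d arbitrary: a)
  case 0
  then show ?case using poly_exprs_zero[of 1] by simp
next
  case (Suc d)
  then obtain s g where *: "a = s * x ^ d + g" "s \<in> R" "g \<in> poly_exprs R x d" by auto
  then have "x * a = s * x ^ Suc d + x * g"
    by (simp add: algebra_simps)
  then show ?case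
    using poly_exprs_SucI[OF *(2) Suc.IH[OF *(3)]] by simp
qed

lemma poly_exprs_Suc: "a \<in> poly_exprs R x d \<Longrightarrow> a \<in> poly_exprs R x (Suc d)"
  using poly_exprs_SucI[OF subring_setD(3)[OF R]] by fastforce

lemma poly_exprs_mono: "d \<le> e \<Longrightarrow> poly_exprs R x d \<subseteq> poly_exprs R x e"
  by (rule lift_Suc_mono_le[of "poly_exprs R x", OF subsetI[OF poly_exprs_Suc]])

lemma poly_exprs_subset_adjoin: "poly_exprs R x d \<subseteq> adjoin R x"
  by (auto simp: adjoin_def)

lemma base_subset_adjoin: "R \<subseteq> adjoin R x"
  using poly_exprs_subset_adjoin[of 1] by auto

lemma var_mem_adjoin: "x \<in> adjoin R x"
proof -
  have "1 \<in> poly_exprs R x 1" using subring_setD(1)[OF R] by simp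
  from poly_exprs_shift[OF this] have "x \<in> poly_exprs R x (Suc 1)" by (simp only: mult_1_right)
  then show ?thesis
    using poly_exprs_subset_adjoin by blast
qed

lemma adjoin_add:
  assumes "a \<in> adjoin R x" "b \<in> adjoin R x"
  shows "a + b \<in> adjoin R x"
proof -
  obtain d e where "a \<in> poly_exprs R x d" "b \<in> poly_exprs R x e"
    using assms by (auto simp: adjoin_def)
  then have "a \<in> poly_exprs R x (max d e)" "b \<in> poly_exprs R x (max d e)"
    using poly_exprs_mono[of d "max d e"] poly_exprs_mono[of e "max d e"] by auto
  then show ?thesis
    using poly_exprs_add poly_exprs_subset_adjoin by blast
qed

lemma adjoin_scale: "r \<in> R \<Longrightarrow> a \<in> adjoin R x \<Longrightarrow> r * a \<in> adjoin R x"
  using poly_exprs_scale by (auto simp: adjoin_def)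

lemma adjoin_shift: "a \<in> adjoin R x \<Longrightarrow> x ^ n * a \<in> adjoin R x"
proof (induction n)
  case (Suc n)
  then obtain d where "x ^ n * a \<in> poly_exprs R x d" by (auto simp: adjoin_def)
  from poly_exprs_shift[OF this] have "x ^ Suc n * a \<in> poly_exprs R x (Suc d)"
    by (simp only: power_Suc mult.assoc)
  then show ?case
    using poly_exprs_subset_adjoin by blast
qed auto

lemma adjoin_mult:
  assumes "a \<in> adjoin R x" "b \<in> adjoin R x"
  shows "a * b \<in> adjoin R x"
proof -
  obtain d where "a \<in> poly_exprs R x d"
    using assms by (auto simp: adjoin_def)
  then show ?thesis
  proof (induction d arbitrary: a)
    case 0
    then show ?case using poly_exprs_zero by (auto simp: adjoin_def)
  next
    case (Suc d)
    then obtain s g where *: "a = s * x ^ d + g" "s \<in> R" "g \<in> poly_exprs R x d" by auto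
    have "a * b = s * (x ^ d * b) + g * b"
      by (simp add: * algebra_simps)
    then show ?case
      using Suc.IH[OF *(3)] adjoin_scale[OF *(2) adjoin_shift[OF assms(2)]] adjoin_add by simp
  qed
qed

lemma subring_set_adjoin: "subring_set (adjoin R x)"
  using adjoin_add adjoin_mult base_subset_adjoin subring_setD(1,2)[OF R]
  by (auto simp: subring_set_def)

lemma adjoin_least:
  assumes "subring_set S" "R \<subseteq> S" "x \<in> S"
  shows "adjoin R x \<subseteq> S"
proof -
  have pow: "x ^ n \<in> S" for n
    using assms by (induction n) (auto intro: subring_setD)
  have "poly_exprs R x d \<subseteq> S" for d
  proof (induction d)
    case 0
    then show ?case using subring_setD(3)[OF assms(1)] by simp
  next
    case (Suc d)
    show ?case
    proof
      fix a assume "a \<in> poly_exprs R x (Suc d)"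
      then obtain r g where "a = r * x ^ d + g" "r \<in> R" "g \<in> poly_exprs R x d" by auto
      moreover from this have "r * x ^ d \<in> S" "g \<in> S"
        using pow assms(2) Suc subring_setD(5)[OF assms(1)] by blast+
      ultimately show "a \<in> S"
        using subring_setD(4)[OF assms(1)] by simp
    qed
  qed
  then show ?thesis by (auto simp: adjoin_def)
qed

context
  fixes J :: "'a set"
  assumes J: "ideal_in (adjoin R x) J"
begin

lemma ideal_in_lead_coeffs: "ideal_in R (lead_coeffs R x J d)"
  unfolding ideal_in_def
proof (intro conjI ballI)
  show "0 \<in> lead_coeffs R x J d"
    using subring_setD(3)[OF R] poly_exprs_zero ideal_inD(2)[OF J]
    by (auto simp: lead_coeffs_def intro!: bexI[of _ 0])
next
  fix a b assume "a \<in> lead_coeffs R x J d" "b \<in> lead_coeffs R x J d"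
  then obtain g h where *: "a \<in> R" "b \<in> R" "g \<in> poly_exprs R x d" "h \<in> poly_exprs R x d"
    "a * x ^ d + g \<in> J" "b * x ^ d + h \<in> J"
    by (auto simp: lead_coeffs_def)
  then have "(a + b) * x ^ d + (g + h) \<in> J"
    using ideal_inD(3)[OF J *(5,6)] by (simp add: algebra_simps)
  then show "a + b \<in> lead_coeffs R x J d"
    using * poly_exprs_add subring_setD(4)[OF R] by (auto simp: lead_coeffs_def)
next
  fix r a assume r: "r \<in> R" and "a \<in> lead_coeffs R x J d"
  then obtain g where *: "a \<in> R" "g \<in> poly_exprs R x d" "a * x ^ d + g \<in> J"
    by (auto simp: lead_coeffs_def)
  then have "(r * a) * x ^ d + r * g \<in> J"
    using ideal_inD(4)[OF J _ *(3), of r] r base_subset_adjoin by (auto simp: algebra_simps)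
  then show "r * a \<in> lead_coeffs R x J d"
    using * r poly_exprs_scale subring_setD(5)[OF R] by (auto simp: lead_coeffs_def)
qed (auto simp: lead_coeffs_def)

text \<open>Multiplication by \<open>x\<close> keeps an element in the ideal and its leading
  coefficient unchanged while raising the degree by one.\<close>

lemma lead_coeffs_Suc: "lead_coeffs R x J d \<subseteq> lead_coeffs R x J (Suc d)"
proof
  fix r assume "r \<in> lead_coeffs R x J d"
  then obtain g where *: "r \<in> R" "g \<in> poly_exprs R x d" "r * x ^ d + g \<in> J"
    by (auto simp: lead_coeffs_def)
  then have "r * x ^ Suc d + x * g \<in> J"
    using ideal_inD(4)[OF J var_mem_adjoin *(3)] by (simp add: algebra_simps)
  then show "r \<in> lead_coeffs R x J (Suc d)"
    using * poly_exprs_shift[OF *(2)] unfolding lead_coeffs_def by blast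
qed

lemma lead_coeffs_mono: "d \<le> e \<Longrightarrow> lead_coeffs R x J d \<subseteq> lead_coeffs R x J e"
  using lead_coeffs_Suc by (rule lift_Suc_mono_le)

end

text \<open>Induction on the degree: from an element of \<open>J'\<close> subtract an element of
  \<open>J\<close> with the same leading coefficient. The difference has smaller degree and still
  lies in \<open>J'\<close>, hence in \<open>J\<close>.\<close>

lemma lead_coeffs_determine_ideal:
  assumes J: "ideal_in (adjoin R x) J" and J': "ideal_in (adjoin R x) J'" and "J \<subseteq> J'"
    and eq: "\<And>d. lead_coeffs R x J d = lead_coeffs R x J' d"
  shows "J = J'"
proof -
  have "f \<in> J" if "f \<in> J'" "f \<in> poly_exprs R x d" for f d
    using that
  proof (induction d arbitrary: f)
    case 0
    then show ?case using ideal_inD(2)[OF J] by simp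
  next
    case (Suc d)
    then obtain r g where *: "f = r * x ^ d + g" "r \<in> R" "g \<in> poly_exprs R x d" by auto
    then have "r \<in> lead_coeffs R x J d"
      using Suc.prems eq by (auto simp: lead_coeffs_def)
    then obtain h where h: "h \<in> poly_exprs R x d" "r * x ^ d + h \<in> J"
      by (auto simp: lead_coeffs_def)
    have neg: "-1 \<in> adjoin R x"
      using base_subset_adjoin subring_setD(2)[OF R] by auto
    have "f + (-1) * (r * x ^ d + h) \<in> J'"
      using Suc.prems h \<open>J \<subseteq> J'\<close> neg ideal_inD(3,4)[OF J'] by blast
    moreover have "f + (-1) * (r * x ^ d + h) = g + (-1) * h"
      by (simp add: *)
    moreover have "g + (-1) * h \<in> poly_exprs R x d"
      using * h poly_exprs_add poly_exprs_scale subring_setD(2)[OF R] by blast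
    ultimately have "g + (-1) * h \<in> J" using Suc.IH by metis
    from ideal_inD(3)[OF J this h(2)] show ?case by (simp add: * add.commute)
  qed
  then show ?thesis
    using \<open>J \<subseteq> J'\<close> ideal_inD(1)[OF J'] by (auto simp: adjoin_def)
qed

text \<open>The leading coefficient ideals increase both along the chain and with the degree. Their
  diagonal stabilizes, which settles all large degrees at once; the finitely many remaining degrees
  are stabilized one by one.\<close>

lemma ideal_acc_adjoin:
  assumes acc: "ideal_acc R"
  shows "ideal_acc (adjoin R x)"
  unfolding ideal_acc_def
proof (intro allI impI)
  fix F :: "nat \<Rightarrow> 'a set"
  assume F: "\<forall>n. ideal_in (adjoin R x) (F n)" and inc: "incseq F"
  let ?L = "\<lambda>m d. lead_coeffs R x (F m) d"
  have mono: "?L m d \<subseteq> ?L m' d'" if "m \<le> m'" "d \<le> d'" for m m' d d'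
  proof -
    have "?L m d \<subseteq> ?L m' d"
      using incseqD[OF inc \<open>m \<le> m'\<close>] by (auto simp: lead_coeffs_def)
    then show ?thesis using lead_coeffs_mono F \<open>d \<le> d'\<close> by blast
  qed
  have stab: "\<exists>N. \<forall>n\<ge>N. G n = G N" if "\<And>n. \<exists>m d. G n = ?L m d" "incseq G" for G
  proof -
    have "ideal_in R (G n)" for n
      using that(1)[of n] ideal_in_lead_coeffs F by auto
    then show ?thesis
      using acc that(2) unfolding ideal_acc_def by blast
  qed
  have "\<exists>N. \<forall>m\<ge>N. ?L m m = ?L N N"
    by (rule stab) (use mono in \<open>auto simp: incseq_def\<close>)
  then obtain N where N: "\<And>m. m \<ge> N \<Longrightarrow> ?L m m = ?L N N" by blast
  have "\<forall>d. \<exists>M. \<forall>m\<ge>M. ?L m d = ?L M d"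
    by (intro allI stab) (use mono in \<open>auto simp: incseq_def\<close>)
  then obtain M where M: "\<And>d m. m \<ge> M d \<Longrightarrow> ?L m d = ?L (M d) d"
    unfolding choice_iff by blast
  \<comment> \<open>Past \<open>B\<close> the diagonal and each of the degrees below
    \<open>N\<close> have stabilized.\<close>
  define B where "B = Max (insert N (M ` {..<N}))"
  have B: "N \<le> B" "\<And>d. d < N \<Longrightarrow> M d \<le> B"
    by (auto simp: B_def)
  have "F n = F B" if "n \<ge> B" for n
  proof -
    have "?L B d = ?L n d" for d
    proof (cases "d < N")
      case True
      then show ?thesis using M[of d B] M[of d n] B(2)[of d] that by simp
    next
      case False
      \<comment> \<open>Squeeze: \<open>?L m d\<close> lies between the diagonal members at
        \<open>N\<close> and at \<open>max m d\<close>, which agree.\<close>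
      have "?L m d = ?L N N" if "m \<ge> N" for m
        using mono[of N m N d] mono[of m "max m d" d "max m d"] N[of "max m d"] that False by auto
      then show ?thesis using B(1) that by simp
    qed
    then show ?thesis
      using lead_coeffs_determine_ideal[of "F B" "F n"] F incseqD[OF inc that] by simp
  qed
  then show "\<exists>N. \<forall>n\<ge>N. F n = F N" by blast
qed

end

text \<open>Elements of \<open>E\<close> are adjoined one at a time. The upper bound
  \<open>S\<close> later forces \<open>T\<close> to be exactly the ring of polynomial
  functions.\<close>

lemma ideal_acc_adjoin_finite:
  assumes "subring_set R" "ideal_acc R" "finite E" "subring_set S" "R \<subseteq> S" "E \<subseteq> S"
  shows "\<exists>T. subring_set T \<and> ideal_acc T \<and> R \<subseteq> T \<and> E \<subseteq> T \<and> T \<subseteq> S"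
  using assms(3,6)
proof (induction E)
  case empty
  then show ?case using assms by auto
next
  case (insert x E)
  then obtain T where T: "subring_set T" "ideal_acc T" "R \<subseteq> T" "E \<subseteq> T" "T \<subseteq> S" by auto
  show ?case
    using subring_set_adjoin[OF T(1)] ideal_acc_adjoin[OF T(1,2)] base_subset_adjoin[OF T(1)]
      var_mem_adjoin[OF T(1)] adjoin_least[OF T(1) assms(4) T(5)] T insert.prems
    by (intro exI[of _ "adjoin T x"]) blast
qed


section \<open>Decomposition into irreducible components\<close>

lemma polynomial_in_entries_sum:
  "(\<And>i. i \<in> I \<Longrightarrow> polynomial_in_entries (f i)) \<Longrightarrow> polynomial_in_entries (\<lambda>A. \<Sum>i\<in>I. f i A)"
  by (induction I rule: infinite_finite_induct) (auto intro: polynomial_in_entries.intros)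

lemma polynomial_in_entries_prod:
  "(\<And>i. i \<in> I \<Longrightarrow> polynomial_in_entries (f i)) \<Longrightarrow> polynomial_in_entries (\<lambda>A. \<Prod>i\<in>I. f i A)"
  by (induction I rule: infinite_finite_induct) (auto intro: polynomial_in_entries.intros)

lemma polynomial_in_entries_det:
  "(\<And>i j. polynomial_in_entries (\<lambda>A. M A $ i $ j)) \<Longrightarrow> polynomial_in_entries (\<lambda>A. det (M A))"
  unfolding det_def
  by (intro polynomial_in_entries_sum polynomial_in_entries_prod polynomial_in_entries.intros)

lemma polynomial_in_entries_diff_const:
  "polynomial_in_entries p \<Longrightarrow> polynomial_in_entries (\<lambda>A. p A - c)"
  using polynomial_in_entries.add[OF _ polynomial_in_entries.const[of "- c"]] by fastforce

text \<open>A variety is the zero set of its whole vanishing ideal. In this form, one separating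
  polynomial for each outside point proves a set closed.\<close>

lemma algebraic_subvariety_iff:
  "algebraic_subvariety V \<longleftrightarrow>
    (\<forall>A. A \<notin> V \<longrightarrow> (\<exists>p. polynomial_in_entries p \<and> p A \<noteq> 0 \<and> (\<forall>B\<in>V. p B = 0)))"
    (is "?l \<longleftrightarrow> ?r")
proof
  assume ?r
  then have "V = {A. \<forall>p\<in>{p. polynomial_in_entries p \<and> (\<forall>B\<in>V. p B = 0)}. p A = 0}"
    by blast
  moreover have "\<forall>p\<in>{p. polynomial_in_entries p \<and> (\<forall>B\<in>V. p B = 0)}. polynomial_in_entries p"
    by simp
  ultimately show ?l
    unfolding algebraic_subvariety_def by (intro exI conjI)
qed (auto simp: algebraic_subvariety_def)

lemma algebraic_subvariety_zeros:
  "(\<And>x. x \<in> X \<Longrightarrow> polynomial_in_entries (p x)) \<Longrightarrow> algebraic_subvariety {A. \<forall>x\<in>X. p x A = 0}"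
  unfolding algebraic_subvariety_iff by blast

lemma algebraic_subvariety_empty: "algebraic_subvariety {}"
  unfolding algebraic_subvariety_iff using polynomial_in_entries.const[of 1] by fastforce

lemma algebraic_subvariety_Int:
  "algebraic_subvariety V \<Longrightarrow> algebraic_subvariety W \<Longrightarrow> algebraic_subvariety (V \<inter> W)"
  unfolding algebraic_subvariety_iff by blast

lemma algebraic_subvariety_Un:
  assumes "algebraic_subvariety V" "algebraic_subvariety W"
  shows "algebraic_subvariety (V \<union> W)"
  unfolding algebraic_subvariety_iff
proof (intro allI impI)
  fix A assume "A \<notin> V \<union> W"
  then obtain p q where "polynomial_in_entries p" "p A \<noteq> 0" "\<forall>B\<in>V. p B = 0"
    "polynomial_in_entries q" "q A \<noteq> 0" "\<forall>B\<in>W. q B = 0"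
    using assms unfolding algebraic_subvariety_iff by blast
  then show "\<exists>p. polynomial_in_entries p \<and> p A \<noteq> 0 \<and> (\<forall>B\<in>V \<union> W. p B = 0)"
    by (intro exI[of _ "\<lambda>A. p A * q A"]) (auto intro: polynomial_in_entries.mult)
qed

lemma algebraic_subvariety_Union:
  "finite S \<Longrightarrow> (\<And>C. C \<in> S \<Longrightarrow> algebraic_subvariety C) \<Longrightarrow> algebraic_subvariety (\<Union>S)"
  by (induction S rule: finite_induct)
    (auto intro: algebraic_subvariety_empty algebraic_subvariety_Un)

section \<open>The Noetherian property and descending chains of varieties\<close>

lemma ideal_acc_constants:
  "ideal_acc (range (\<lambda>c A. c) :: ('a \<Rightarrow> 'b::field) set)"
  unfolding ideal_acc_def
proof (intro allI impI)
  let ?K = "range (\<lambda>c A. c) :: ('a \<Rightarrow> 'b) set"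
  fix F :: "nat \<Rightarrow> ('a \<Rightarrow> 'b) set"
  assume F: "\<forall>n. ideal_in ?K (F n)" and inc: "incseq F"
  \<comment> \<open>The constants form a copy of a field: a nonzero constant \<open>c\<close> in an
    ideal yields every \<open>d\<close> as \<open>(d / c) * c\<close>. So the only ideals are zero
    and everything.\<close>
  have full: "F n = ?K" if f: "f \<in> F n" "f \<noteq> 0" for f n
  proof
    have "f \<in> ?K" using ideal_inD(1) F f(1) by blast
    then obtain c where c: "f = (\<lambda>A. c)" by blast
    with f(2) have "c \<noteq> 0" by (auto simp: func_zero)
    have "(\<lambda>A. d) \<in> F n" for d
    proof -
      have "(\<lambda>A. d / c) * f \<in> F n"
        using F f by (intro ideal_inD(4)[of ?K]) auto
      moreover have "(\<lambda>A. d / c) * f = (\<lambda>A. d)"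
        using c \<open>c \<noteq> 0\<close> by (simp add: func_times)
      ultimately show ?thesis by simp
    qed
    then show "?K \<subseteq> F n" by auto
    show "F n \<subseteq> ?K" using F ideal_inD(1) by blast
  qed
  show "\<exists>N. \<forall>n\<ge>N. F n = F N"
  proof (cases "\<forall>n. F n = {0}")
    case False
    then obtain N where "F N \<noteq> {0}" by blast
    moreover have "0 \<in> F N" using F ideal_inD(2) by blast
    ultimately obtain f where "f \<in> F N" "f \<noteq> 0" by blast
    then have "F n = ?K" if "n \<ge> N" for n
      using full incseqD[OF inc that] by blast
    then show ?thesis by (intro exI[of _ N]) simp
  qed auto
qed

text \<open>The finitely many coordinate functions generate the polynomial functions over the
  constants, so the basis theorem applies.\<close>

lemma ideal_acc_polynomials: "ideal_acc {p :: 'n::finite cmat \<Rightarrow> complex. polynomial_in_entries p}"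
proof -
  let ?P = "{p :: 'n cmat \<Rightarrow> complex. polynomial_in_entries p}"
  let ?K = "range (\<lambda>c A. c) :: ('n cmat \<Rightarrow> complex) set"
  let ?E = "range (\<lambda>(i, j) A. A $ i $ j) :: ('n cmat \<Rightarrow> complex) set"
  have "subring_set ?P"
    unfolding subring_set_def using polynomial_in_entries.intros
    by (auto simp: func_plus func_times func_one fun_Compl_def)
  moreover have "subring_set ?K"
    unfolding subring_set_def by (auto simp: func_plus func_times func_one fun_Compl_def)
  moreover have "?K \<subseteq> ?P" "?E \<subseteq> ?P"
    by (auto intro: polynomial_in_entries.intros)
  moreover have "ideal_acc ?K" by (rule ideal_acc_constants)
  moreover have "finite ?E" by simp
  ultimately have "\<exists>T. subring_set T \<and> ideal_acc T \<and> ?K \<subseteq> T \<and> ?E \<subseteq> T \<and> T \<subseteq> ?P"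
    by (intro ideal_acc_adjoin_finite)
  then obtain T where T: "subring_set T" "ideal_acc T" "?K \<subseteq> T" "?E \<subseteq> T" "T \<subseteq> ?P"
    by (elim exE conjE)
  have "p \<in> T" if "polynomial_in_entries p" for p
    using that
  proof induction
    case (add p q)
    then show ?case using subring_setD(4)[OF T(1)] by (simp add: func_plus)
  next
    case (mult p q)
    then show ?case using subring_setD(5)[OF T(1)] by (simp add: func_times)
  qed (use T in auto)
  then have "T = ?P" using T by auto
  then show ?thesis using T by simp
qed

text \<open>A strictly descending chain of varieties would have an increasing chain of vanishing
  ideals. Where the ideals stabilize, so do the varieties, because each is recovered from its
  ideal.\<close>

lemma wf_algebraic_subvariety:
  "wf {(W, V :: 'n::finite cmat set). algebraic_subvariety W \<and> algebraic_subvariety V \<and> W \<subset> V}"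
  unfolding wf_iff_no_infinite_down_chain
proof
  let ?P = "{p :: 'n cmat \<Rightarrow> complex. polynomial_in_entries p}"
  assume "\<exists>V :: nat \<Rightarrow> 'n cmat set. \<forall>i. (V (Suc i), V i) \<in>
    {(W, V). algebraic_subvariety W \<and> algebraic_subvariety V \<and> W \<subset> V}"
  then obtain V :: "nat \<Rightarrow> 'n cmat set" where
    *: "\<forall>i. (V (Suc i), V i) \<in> {(W, V). algebraic_subvariety W \<and> algebraic_subvariety V \<and> W \<subset> V}"
    by (elim exE)
  have V: "algebraic_subvariety (V i)" "V (Suc i) \<subset> V i" for i
    using *[rule_format, of i] by auto
  define F where "F i = {p \<in> ?P. \<forall>A\<in>V i. p A = 0}" for i
  have "ideal_in ?P (F i)" for i
    unfolding ideal_in_def F_def using polynomial_in_entries.intros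
    by (auto simp: func_plus func_times func_zero)
  moreover have "incseq F"
    unfolding incseq_Suc_iff F_def using V(2) by blast
  ultimately obtain N where "F (Suc N) = F N"
    using ideal_acc_polynomials unfolding ideal_acc_def by (metis le_Suc_eq order_refl)
  moreover obtain A where "A \<in> V N" "A \<notin> V (Suc N)"
    using V(2)[of N] by blast
  then obtain p where "p \<in> F (Suc N)" "p A \<noteq> 0"
    using V(1)[of "Suc N"] unfolding algebraic_subvariety_iff F_def by blast
  ultimately show False
    using \<open>A \<in> V N\<close> by (auto simp: F_def)
qed

text \<open>Noetherian induction: a nonempty variety that is not irreducible splits into two
  strictly smaller ones.\<close>

lemma finite_irreducible_cover:
  "algebraic_subvariety V \<Longrightarrow> \<exists>S. finite S \<and> (\<forall>C\<in>S. irreducible_variety C) \<and> V = \<Union>S"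
proof (induction V rule: wf_induct_rule[OF wf_algebraic_subvariety])
  case (1 V)
  consider "V = {}" | "irreducible_variety V" | W1 W2 where "algebraic_subvariety W1"
    "algebraic_subvariety W2" "V = W1 \<union> W2" "W1 \<subset> V" "W2 \<subset> V"
    using 1(2) unfolding irreducible_variety_def by blast
  then show ?case
  proof cases
    case 1
    then show ?thesis by (intro exI[of _ "{}"]) auto
  next
    case 2
    then show ?thesis by (intro exI[of _ "{V}"]) auto
  next
    case 3
    obtain S1 S2 where "finite S1" "\<forall>C\<in>S1. irreducible_variety C" "W1 = \<Union>S1"
      "finite S2" "\<forall>C\<in>S2. irreducible_variety C" "W2 = \<Union>S2"
      using 1(1)[of W1] 1(1)[of W2] 1(2) 3 by auto
    with 3 show ?thesis by (intro exI[of _ "S1 \<union> S2"]) auto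
  qed
qed

text \<open>\<open>W\<close> is the union of the closed sets \<open>W \<inter> C\<close> and
  \<open>W \<inter> \<Union>S\<close>, so irreducibility puts it inside one of them; then recurse on
  \<open>S\<close>.\<close>

lemma irreducible_variety_subset_Union:
  assumes "irreducible_variety W" "finite S" "\<And>C. C \<in> S \<Longrightarrow> algebraic_subvariety C" "W \<subseteq> \<Union>S"
  shows "\<exists>C\<in>S. W \<subseteq> C"
  using assms(2-)
proof (induction S rule: finite_induct)
  case empty
  then show ?case using assms(1) by (auto simp: irreducible_variety_def)
next
  case (insert C S)
  have "algebraic_subvariety W"
    using assms(1) by (auto simp: irreducible_variety_def)
  then have "algebraic_subvariety (W \<inter> C)" "algebraic_subvariety (W \<inter> \<Union>S)"
    using insert by (auto intro!: algebraic_subvariety_Int algebraic_subvariety_Union)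
  moreover have "W = (W \<inter> C) \<union> (W \<inter> \<Union>S)" using insert by auto
  ultimately consider "W = W \<inter> C" | "W = W \<inter> \<Union>S"
    using assms(1) unfolding irreducible_variety_def by metis
  then show ?case
    by cases (use insert in auto)
qed

lemma irreducible_variety_imp_algebraic: "irreducible_variety C \<Longrightarrow> algebraic_subvariety C"
  by (simp add: irreducible_variety_def)

lemma irreducible_componentD:
  assumes "irreducible_component C V"
  shows "irreducible_variety C" "algebraic_subvariety C" "C \<subseteq> V"
    "irreducible_variety W \<Longrightarrow> C \<subseteq> W \<Longrightarrow> W \<subseteq> V \<Longrightarrow> W = C"
  using assms irreducible_variety_imp_algebraic by (auto simp: irreducible_component_def)

text \<open>The components are the maximal members of a finite irreducible cover, since every
  irreducible subset of \<open>V\<close> lies in some member of that cover.\<close>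

lemma irreducible_components:
  assumes "algebraic_subvariety V"
  shows "finite {C. irreducible_component C V}" "\<Union>{C. irreducible_component C V} = V"
proof -
  obtain S where S: "finite S" "\<And>C. C \<in> S \<Longrightarrow> irreducible_variety C" "V = \<Union>S"
    using finite_irreducible_cover[OF assms] by auto
  have cover: "\<exists>C\<in>S. W \<subseteq> C" if "irreducible_variety W" "W \<subseteq> V" for W
    using irreducible_variety_subset_Union[OF that(1) S(1)] S that(2)
      irreducible_variety_imp_algebraic by auto
  have "{C. irreducible_component C V} \<subseteq> S"
  proof clarify
    fix W assume W: "irreducible_component W V"
    then obtain C where "C \<in> S" "W \<subseteq> C"
      using cover irreducible_componentD(1,3) by blast
    then show "W \<in> S"
      using irreducible_componentD(4)[OF W, of C] S by auto
  qed
  then show "finite {C. irreducible_component C V}" using S(1) finite_subset by blast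
  have "\<exists>C. irreducible_component C V \<and> A \<in> C" if "A \<in> V" for A
  proof -
    obtain C where C: "C \<in> S" "A \<in> C" using S(3) \<open>A \<in> V\<close> by blast
    obtain M where M: "M \<in> S" "C \<subseteq> M" "\<And>B. B \<in> S \<Longrightarrow> M \<subseteq> B \<Longrightarrow> M = B"
      using finite_has_maximal2[OF S(1) C(1)] by metis
    have "irreducible_component M V"
      unfolding irreducible_component_def
    proof (intro conjI allI impI)
      fix W assume W: "irreducible_variety W \<and> M \<subseteq> W \<and> W \<subseteq> V"
      then obtain B where "B \<in> S" "W \<subseteq> B" using cover by blast
      with M(3)[of B] W show "W = M" by auto
    qed (use M S in auto)
    with C M show ?thesis by auto
  qed
  then show "\<Union>{C. irreducible_component C V} = V"
    using irreducible_componentD(3) by blast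
qed


section \<open>The torus action\<close>

text \<open>The action of the diagonal matrix with entries \<open>exp (z * b $ i)\<close>.
  Exponential parametrization makes every orbit an entire curve, so the identity theorem can stand
  in for connectedness of the torus.\<close>

definition torus_flow :: "'n::finite cvec \<Rightarrow> complex \<Rightarrow> 'n cmat \<Rightarrow> 'n cmat" where
  "torus_flow b z A = (\<chi> i j. exp (z * b $ i) * A $ i $ j * exp (- 3 * z * b $ j))"

lemma torus_flow_0: "torus_flow b 0 A = A"
  by (simp add: torus_flow_def vec_eq_iff)

lemma polynomial_in_entries_torus_flow:
  "polynomial_in_entries p \<Longrightarrow> polynomial_in_entries (\<lambda>A. p (torus_flow b z A))"
proof (induction rule: polynomial_in_entries.induct)
  case (entry i j)
  show ?case unfolding torus_flow_def by (simp, intro polynomial_in_entries.intros)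
qed (auto intro: polynomial_in_entries.intros)

lemma holomorphic_on_torus_flow:
  "polynomial_in_entries p \<Longrightarrow> (\<lambda>z. p (torus_flow b z A)) holomorphic_on UNIV"
proof (induction rule: polynomial_in_entries.induct)
  case (entry i j)
  show ?case unfolding torus_flow_def by (simp, intro holomorphic_intros)
qed (auto intro: holomorphic_intros)

text \<open>If the curve leaves \<open>C\<close> at some time, a polynomial vanishing on
  \<open>C\<close> pulls back to a nonzero entire function, so it meets \<open>C\<close> at only
  countably many times. Finitely many such sets of times cannot cover the complex plane.\<close>

lemma torus_flow_mem_one_of:
  assumes S: "finite S" "\<And>C. C \<in> S \<Longrightarrow> algebraic_subvariety C"
    and cover: "\<And>z. torus_flow b z A \<in> \<Union>S"
  shows "\<exists>C\<in>S. \<forall>z. torus_flow b z A \<in> C"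
proof (rule ccontr)
  assume *: "\<not> ?thesis"
  have "countable {z. torus_flow b z A \<in> C}" if "C \<in> S" for C
  proof -
    from * that obtain w where "torus_flow b w A \<notin> C" by blast
    then obtain p where p: "polynomial_in_entries p" "p (torus_flow b w A) \<noteq> 0" "\<forall>B\<in>C. p B = 0"
      using S(2) \<open>C \<in> S\<close> unfolding algebraic_subvariety_iff by blast
    have "countable {z. p (torus_flow b z A) = 0}"
    proof (rule ccontr)
      assume "uncountable {z. p (torus_flow b z A) = 0}"
      then have "(\<lambda>z. p (torus_flow b z A)) = (\<lambda>z. 0)"
        using holomorphic_countable_equal_UNIV[OF holomorphic_on_torus_flow[OF p(1)]]
          holomorphic_on_const by blast
      then show False using p(2) by meson
    qed
    then show ?thesis
      by (rule countable_subset[rotated]) (use p(3) in auto)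
  qed
  then have "countable (\<Union>C\<in>S. {z. torus_flow b z A \<in> C})"
    using S(1) countable_finite by blast
  moreover have "(\<Union>C\<in>S. {z. torus_flow b z A \<in> C}) = UNIV"
    using cover by auto
  ultimately show False
    using uncountable_UNIV_complex by simp
qed

text \<open>Each orbit starting in \<open>C\<close> stays in a single component, so \<open>C\<close>
  is covered by the sets \<open>?stay D\<close>. Irreducibility selects one \<open>D\<close>; time
  zero gives \<open>C \<subseteq> D\<close>, and maximality gives \<open>D = C\<close>.\<close>

lemma irreducible_component_torus_flow:
  assumes V: "algebraic_subvariety V" "\<And>A z. A \<in> V \<Longrightarrow> torus_flow b z A \<in> V"
    and C: "irreducible_component C V" and "A \<in> C"
  shows "torus_flow b z A \<in> C"
proof -
  let ?S = "{C. irreducible_component C V}"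
  let ?stay = "\<lambda>D. {A. \<forall>z. torus_flow b z A \<in> D}"
  note comps = irreducible_components[OF V(1)]
  have "\<exists>D\<in>?S. \<forall>z. torus_flow b z B \<in> D" if "B \<in> C" for B
  proof (rule torus_flow_mem_one_of)
    show "torus_flow b z B \<in> \<Union>?S" for z
      using V(2) irreducible_componentD(3)[OF C] \<open>B \<in> C\<close> comps(2) by blast
  qed (use comps(1) irreducible_componentD(2) in auto)
  then have "C \<subseteq> \<Union>(?stay ` ?S)" by blast
  \<comment> \<open>\<open>?stay D\<close> is the intersection over all \<open>z\<close> of
    preimages of \<open>D\<close> under maps linear in the matrix entries.\<close>
  moreover have "algebraic_subvariety (?stay D)" if "D \<in> ?S" for D
    unfolding algebraic_subvariety_iff
  proof (intro allI impI)
    fix B assume "B \<notin> ?stay D"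
    then obtain z where "torus_flow b z B \<notin> D" by blast
    then obtain p where "polynomial_in_entries p" "p (torus_flow b z B) \<noteq> 0" "\<forall>B\<in>D. p B = 0"
      using irreducible_componentD(2)[of D V] \<open>D \<in> ?S\<close> unfolding algebraic_subvariety_iff by blast
    then show "\<exists>p. polynomial_in_entries p \<and> p B \<noteq> 0 \<and> (\<forall>B\<in>?stay D. p B = 0)"
      by (intro exI[of _ "\<lambda>B. p (torus_flow b z B)"]) (auto intro: polynomial_in_entries_torus_flow)
  qed
  ultimately obtain D where D: "irreducible_component D V" "C \<subseteq> ?stay D"
    using irreducible_variety_subset_Union[OF irreducible_componentD(1)[OF C], of "?stay ` ?S"]
      comps(1) by auto
  have "C \<subseteq> D" using D(2) torus_flow_0 by (metis (mono_tags, lifting) mem_Collect_eq subset_iff)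
  then have "D = C"
    using irreducible_componentD(1,3)[OF D(1)] irreducible_componentD(4)[OF C] by blast
  with D(2) \<open>A \<in> C\<close> show ?thesis by auto
qed

section \<open>Diagonal matrices and their action in coordinates\<close>

lemma diag_matrix_mult: "\<Delta>[u] ** \<Delta>[v] = \<Delta>[u * v]"
  by (auto simp: diag_matrix_def matrix_matrix_mult_def vec_eq_iff if_distrib[of "\<lambda>x. x * _"] cong: if_cong)

lemma diag_matrix_mult_left: "(\<Delta>[u] ** A) $ i $ j = u $ i * A $ i $ j"
  by (simp add: diag_matrix_def matrix_matrix_mult_def if_distrib[of "\<lambda>x. x * _"] cong: if_cong)

lemma diag_matrix_mult_right: "(A ** \<Delta>[u]) $ i $ j = A $ i $ j * u $ j"
  by (simp add: diag_matrix_def matrix_matrix_mult_def if_distrib[of "\<lambda>x. _ * x"] cong: if_cong)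

lemma matrix_inv_eqI:
  fixes A B :: "'a::semiring_1 ^ 'n ^ 'n"
  assumes "A ** B = mat 1" "B ** A = mat 1"
  shows "matrix_inv A = B"
  unfolding matrix_inv_def
  by (rule some_equality) (use assms in \<open>auto, metis matrix_mul_assoc matrix_mul_lid matrix_mul_rid\<close>)

lemma diag_matrix_inverse:
  assumes "\<And>i. d $ i \<noteq> 0"
  shows "\<Delta>[d] ** \<Delta>[\<chi> i. inverse (d $ i)] = mat 1" "matrix_inv \<Delta>[d] = \<Delta>[\<chi> i. inverse (d $ i)]" "invertible \<Delta>[d]"
proof -
  have *: "\<Delta>[d] ** \<Delta>[\<chi> i. inverse (d $ i)] = mat 1" "\<Delta>[\<chi> i. inverse (d $ i)] ** \<Delta>[d] = mat 1"
    using assms by (simp_all add: vec_eq_iff diag_matrix_mult_left) (simp_all add: diag_matrix_def mat_def)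
  then show "matrix_inv \<Delta>[d] = \<Delta>[\<chi> i. inverse (d $ i)]"
    by (intro matrix_inv_eqI)
  show "\<Delta>[d] ** \<Delta>[\<chi> i. inverse (d $ i)] = mat 1" by (fact *)
  show "invertible \<Delta>[d]" using * by (auto simp: invertible_def)
qed

lemma invertible_diag_matrixD: "invertible \<Delta>[d] \<Longrightarrow> d $ i \<noteq> 0"
  using diag_matrix_mult_left[of d _ i i]
  by (auto simp: invertible_def mat_def vec_eq_iff) (metis mult_zero_left zero_neq_one)

lemma diag_action_entry:
  assumes "\<And>i. d $ i \<noteq> 0"
  shows "(\<Delta>[d] ** A ** matrix_inv (\<Delta>[d] ** \<Delta>[d] ** \<Delta>[d])) $ i $ j = d $ i * A $ i $ j / d $ j ^ 3"
  using assms
  by (simp add: diag_matrix_mult diag_matrix_inverse diag_matrix_mult_right diag_matrix_mult_left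
      power3_eq_cube divide_inverse)

lemma diagonal_invariant_torus_flow:
  assumes "diagonal_invariant V" "A \<in> V"
  shows "torus_flow b z A \<in> V"
proof -
  define d where "d = (\<chi> i. exp (z * b $ i))"
  have d: "d $ i \<noteq> 0" for i by (simp add: d_def)
  have "torus_flow b z A = \<Delta>[d] ** A ** matrix_inv (\<Delta>[d] ** \<Delta>[d] ** \<Delta>[d])"
    using diag_action_entry[OF d, of A]
    by (simp add: vec_eq_iff torus_flow_def d_def divide_inverse exp_minus flip: exp_of_nat_mult)
      (simp add: mult.assoc)
  then show ?thesis
    using assms diag_matrix_inverse(3)[OF d] unfolding diagonal_invariant_def Let_def by blast
qed


section \<open>Kernel vectors and the exceptional set, for arbitrary supports of 0-1 vectors\<close>

definition indicator_vec :: "'n::finite set \<Rightarrow> 'n cvec" where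
  "indicator_vec K = (\<chi> i. if i \<in> K then 1 else 0)"

lemma det_eq_1_imp_trivial_kernel:
  fixes A :: "'n::finite cmat"
  shows "det A = 1 \<Longrightarrow> A *v x = 0 \<Longrightarrow> x = 0"
  by (metis invertible_det_nz invertible_left_inverse matrix_left_invertible_ker zero_neq_one)

text \<open>If \<open>v\<close> has support \<open>K\<close> and \<open>A v\<close> vanishes nowhere on \<open>K\<close>, then
  \<open>v\<^sub>i + w\<^sub>i (A v)\<^sub>i = 0\<close> for nonzero weights \<open>w\<^sub>i\<close>. Conjugation by the torus element with
  \<open>d\<^sub>i\<^sup>-\<^sup>2 = w\<^sub>i\<close> turns this into a kernel vector of the matrix whose determinant is \<open>1\<close>.\<close>

lemma torus_det_imp_no_solution:
  assumes K: "K \<noteq> {}"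
    and det: "\<And>b z. det (mat 1 + \<Delta>[indicator_vec K] ** torus_flow b z A) = 1"
  shows "indicator_vec K + A *v (indicator_vec K * u) \<noteq> 0"
proof
  assume eq: "indicator_vec K + A *v (indicator_vec K * u) = 0"
  let ?I = "indicator_vec K :: 'a cvec"
  let ?e = "A *v ?I"
  \<comment> \<open>On \<open>K\<close> the perturbed vector has entries
    \<open>u $ i + \<epsilon>\<close>, and its image has entries
    \<open>\<epsilon> * ?e $ i - 1\<close>. Only finitely many values make one of these vanish; if
    \<open>?e $ i = 0\<close>, division by zero merely excludes the value 0.\<close>
  obtain \<epsilon> where \<epsilon>: "\<epsilon> \<notin> range (\<lambda>i. - (u $ i)) \<union> range (\<lambda>i. 1 / ?e $ i)"
    using ex_new_if_finite[OF infinite_UNIV_char_0, of "range (\<lambda>i. - (u $ i)) \<union> range (\<lambda>i. 1 / ?e $ i)"]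
    by auto
  define v where "v = ?I * u + \<epsilon> *s ?I"
  have "A *v (?I * u) = - ?I" using eq by (simp add: eq_neg_iff_add_eq_0 add.commute)
  then have Av: "A *v v = - ?I + \<epsilon> *s ?e"
    by (simp add: v_def matrix_vector_right_distrib vector_scalar_commute)
  have v: "v $ i \<noteq> 0" "(A *v v) $ i \<noteq> 0" if "i \<in> K" for i
  proof -
    have "u $ i + \<epsilon> \<noteq> 0"
      using \<epsilon> by (auto simp: add_eq_0_iff)
    then show "v $ i \<noteq> 0" using that by (simp add: v_def indicator_vec_def)
    have "\<epsilon> \<noteq> 1 / ?e $ i" using \<epsilon> by blast
    then have "\<epsilon> * ?e $ i \<noteq> 1"
      by (metis mult_zero_right nonzero_eq_divide_eq zero_neq_one)
    then show "(A *v v) $ i \<noteq> 0" using that by (simp add: Av) (simp add: indicator_vec_def)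
  qed
  have v0: "v $ i = 0" if "i \<notin> K" for i
    using that by (simp add: v_def indicator_vec_def)
  \<comment> \<open>Chosen so that \<open>exp (- 2 * b $ i)\<close> is the weight
    \<open>- v $ i / (A *v v) $ i\<close> on \<open>K\<close>.\<close>
  define b where "b = (\<chi> i. - Ln (- v $ i / (A *v v) $ i) / 2)"
  have b: "exp (3 * b $ i) * v $ i + exp (b $ i) * (A *v v) $ i = 0" if "i \<in> K" for i
  proof -
    have "exp (- 2 * b $ i) = - v $ i / (A *v v) $ i"
      using v[OF that] by (simp add: b_def)
    then have "exp (3 * b $ i) * (v $ i + exp (- 2 * b $ i) * (A *v v) $ i) = 0"
      using v[OF that] by simp
    moreover have "exp (3 * b $ i) * exp (- 2 * b $ i) = exp (b $ i)"
      by (simp flip: exp_add)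
    ultimately show ?thesis by (simp add: distrib_left flip: mult.assoc)
  qed
  \<comment> \<open>With \<open>D\<close> the diagonal matrix of entries \<open>exp (b $ i)\<close>,
    this is \<open>x = D^3 v\<close>, so the conjugated matrix \<open>D A D^(-3)\<close> sends
    \<open>x\<close> to \<open>D A v\<close>.\<close>
  define x where "x = (\<chi> i. exp (3 * b $ i) * v $ i)"
  have "(torus_flow b 1 A *v x) $ i = exp (b $ i) * (A *v v) $ i" for i
    by (simp add: matrix_vector_mult_def torus_flow_def x_def sum_distrib_left exp_minus field_simps)
  then have "((\<Delta>[?I] ** torus_flow b 1 A) *v x) $ i = ?I $ i * (exp (b $ i) * (A *v v) $ i)" for i
    by (simp add: matrix_vector_mult_def diag_matrix_mult_left mult.assoc flip: sum_distrib_left)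
  then have "(mat 1 + \<Delta>[?I] ** torus_flow b 1 A) *v x = 0"
    using b v0 by (simp add: vec_eq_iff matrix_vector_mult_add_rdistrib)
      (simp add: x_def indicator_vec_def)
  then have "x = 0" using det det_eq_1_imp_trivial_kernel by blast
  moreover obtain i where "i \<in> K" using K by auto
  ultimately show False using v(1) by (simp add: x_def vec_eq_iff)
qed

lemma generically_mono:
  "generically V P \<Longrightarrow> (\<And>A. A \<in> V \<Longrightarrow> P A \<Longrightarrow> Q A) \<Longrightarrow> generically V Q"
  unfolding generically_def by blast

text \<open>One exceptional set serves all supports \<open>K\<close> simultaneously, because there
  are finitely many components and finitely many subsets of the index type.\<close>

lemma generically_no_solution:
  fixes V :: "'n::finite cmat set"
  assumes alg: "algebraic_subvariety V" and "V \<noteq> {}" and inv: "diagonal_invariant V"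
  shows "generically V (\<lambda>A. \<forall>K u. K \<noteq> {} \<longrightarrow> det (mat 1 + \<Delta>[indicator_vec K] ** A) = 1 \<longrightarrow>
    indicator_vec K + A *v (indicator_vec K * u) \<noteq> 0)"
proof -
  define N where "N K = {A :: 'n cmat. det (mat 1 + \<Delta>[indicator_vec K] ** A) = 1}" for K
  define T where "T = {(C, K). irreducible_component C V \<and> \<not> C \<subseteq> N K}"
  define Y where "Y = \<Union>((\<lambda>(C, K). C \<inter> N K) ` T)"
  note comps = irreducible_components[OF alg]
  have algN: "algebraic_subvariety (N K)" for K
  proof -
    have "polynomial_in_entries (\<lambda>A :: 'n cmat. det (mat 1 + \<Delta>[indicator_vec K] ** A) - 1)"
      by (intro polynomial_in_entries_diff_const polynomial_in_entries_det)
        (simp add: diag_matrix_mult_left polynomial_in_entries.intros)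
    then show ?thesis
      using algebraic_subvariety_zeros[of "{()}" "\<lambda>_ A. det (mat 1 + \<Delta>[indicator_vec K] ** A) - 1"]
      by (simp add: N_def)
  qed
  have "finite T"
    by (rule finite_subset[of _ "{C. irreducible_component C V} \<times> UNIV"])
      (auto simp: T_def comps)
  moreover have alg_piece: "algebraic_subvariety (C \<inter> N K)" if "(C, K) \<in> T" for C K
    using that algN irreducible_componentD(2) by (auto simp: T_def intro: algebraic_subvariety_Int)
  ultimately have algY: "algebraic_subvariety Y"
    unfolding Y_def by (intro algebraic_subvariety_Union) auto
  \<comment> \<open>A component \<open>W\<close> inside \<open>Y\<close> would lie in a single piece
    \<open>C \<inter> N K\<close>. Maximality then gives \<open>C = W\<close>, so
    \<open>C \<subseteq> N K\<close>, contrary to the choice of \<open>T\<close>.\<close>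
  have small: "\<not> W \<subseteq> Y" if W: "irreducible_component W V" for W
  proof
    assume "W \<subseteq> Y"
    then have "\<exists>B\<in>(\<lambda>(C, K). C \<inter> N K) ` T. W \<subseteq> B"
      unfolding Y_def using \<open>finite T\<close> alg_piece
      by (intro irreducible_variety_subset_Union[OF irreducible_componentD(1)[OF W]]) auto
    then obtain C K where CK: "(C, K) \<in> T" "W \<subseteq> C \<inter> N K"
      by auto
    then have "irreducible_component C V" by (simp add: T_def)
    then have "C = W"
      using irreducible_componentD(1,3)[of C V] irreducible_componentD(4)[OF W, of C] CK by auto
    then show False using CK by (auto simp: T_def)
  qed
  have "Y \<subseteq> V"
    using irreducible_componentD(3) by (fastforce simp: Y_def T_def)
  moreover have "Y \<noteq> V"
    using small \<open>V \<noteq> {}\<close> comps(2) irreducible_componentD(3) by fastforce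
  moreover have "indicator_vec K + A *v (indicator_vec K * u) \<noteq> 0"
    if A: "A \<in> V - Y" and "K \<noteq> {}" and "det (mat 1 + \<Delta>[indicator_vec K] ** A) = 1" for A K u
  proof -
    obtain C where C: "irreducible_component C V" "A \<in> C" using A comps(2) by auto
    \<comment> \<open>Otherwise \<open>(C, K)\<close> belongs to \<open>T\<close>, and
      \<open>A\<close>, lying in \<open>C \<inter> N K\<close>, would be in
      \<open>Y\<close>.\<close>
    have "C \<subseteq> N K"
      using A C that(3) by (force simp: Y_def T_def N_def)
    then have "torus_flow b z A \<in> N K" for b z
      using irreducible_component_torus_flow[OF alg _ C] diagonal_invariant_torus_flow[OF inv] by blast
    then show ?thesis
      using torus_det_imp_no_solution[OF \<open>K \<noteq> {}\<close>] by (simp add: N_def)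
  qed
  ultimately show ?thesis
    unfolding generically_def using algY small by (intro exI[of _ Y]) blast
qed

section \<open>Druzkowski matrices\<close>

lemma complex_jacobian_druzkowski_map:
  "complex_jacobian (druzkowski_map A) x = mat 1 + \<Delta>[\<chi> i. 3 * ((A *v x) $ i)\<^sup>2] ** A"
proof -
  have "deriv (\<lambda>z. druzkowski_map A (x + z *s axis j 1) $ i) 0 =
      (if i = j then 1 else 0) + 3 * ((A *v x) $ i)\<^sup>2 * A $ i $ j" for i j
  proof (rule DERIV_imp_deriv)
    have "(A *v axis j 1) $ i = A $ i $ j"
      by (simp add: matrix_vector_mult_def axis_def if_distrib[of "\<lambda>x. _ * x"] cong: if_cong)
    then have "(\<lambda>z. druzkowski_map A (x + z *s axis j 1) $ i) =
        (\<lambda>z. x $ i + z * (if i = j then 1 else 0) + ((A *v x) $ i + z * A $ i $ j) ^ 3)"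
      by (auto simp: druzkowski_map_def power3_eq_cube matrix_vector_right_distrib
          vector_scalar_commute axis_def)
    then show "((\<lambda>z. druzkowski_map A (x + z *s axis j 1) $ i) has_field_derivative
        (if i = j then 1 else 0) + 3 * ((A *v x) $ i)\<^sup>2 * A $ i $ j) (at 0)"
      by (auto intro!: derivative_eq_intros)
  qed
  then show ?thesis
    by (simp add: complex_jacobian_def vec_eq_iff diag_matrix_mult_left mat_def)
qed

lemma mem_druzkowski_matrices:
  "A \<in> druzkowski_matrices \<longleftrightarrow> (\<forall>x. det (mat 1 + \<Delta>[\<chi> i. 3 * ((A *v x) $ i)\<^sup>2] ** A) = 1)"
  by (simp add: druzkowski_matrices_def complex_jacobian_druzkowski_map)

text \<open>Supplies nonemptiness: the empty variety has no proper subset to serve as exceptional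
  set.\<close>

lemma zero_mem_druzkowski_matrices: "(0 :: 'n::finite cmat) \<in> druzkowski_matrices"
proof -
  have "mat 1 + \<Delta>[u] ** 0 = (mat 1 :: 'n cmat)" for u
    by (simp add: vec_eq_iff diag_matrix_mult_left)
  then show ?thesis by (simp add: mem_druzkowski_matrices)
qed

lemma algebraic_subvariety_druzkowski_matrices:
  "algebraic_subvariety (druzkowski_matrices :: 'n::finite cmat set)"
proof -
  have "polynomial_in_entries (\<lambda>A :: 'n cmat. det (mat 1 + \<Delta>[\<chi> i. 3 * ((A *v x) $ i)\<^sup>2] ** A) - 1)" for x
    by (intro polynomial_in_entries_diff_const polynomial_in_entries_det)
      (simp add: diag_matrix_mult_left matrix_vector_mult_def power2_eq_square,
        intro polynomial_in_entries.intros polynomial_in_entries_sum)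
  from algebraic_subvariety_zeros[of UNIV, OF this] show ?thesis
    by (simp add: druzkowski_matrices_def complex_jacobian_druzkowski_map)
qed

text \<open>Inclusion for all \<open>d\<close> gives equality, since the coordinatewise inverse of
  \<open>d\<close> acts as the inverse map.\<close>

lemma diagonal_invariantI:
  assumes "\<And>d A. (\<And>i. d $ i \<noteq> 0) \<Longrightarrow> A \<in> V \<Longrightarrow> (\<chi> i j. d $ i * A $ i $ j / d $ j ^ 3) \<in> V"
  shows "diagonal_invariant V"
  unfolding diagonal_invariant_def Let_def
proof (intro allI impI)
  fix d :: "'a cvec" assume "invertible \<Delta>[d]"
  then have d: "d $ i \<noteq> 0" for i by (rule invertible_diag_matrixD)
  let ?f = "\<lambda>d A. (\<chi> i j. d $ i * A $ i $ j / d $ j ^ 3) :: 'a cmat"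
  let ?d' = "\<chi> i. 1 / d $ i"
  have "(\<lambda>A. \<Delta>[d] ** A ** matrix_inv (\<Delta>[d] ** \<Delta>[d] ** \<Delta>[d])) = ?f d"
    using diag_action_entry[OF d] by (simp add: fun_eq_iff vec_eq_iff)
  moreover have "?f d ` V = V"
  proof (intro equalityI subsetI)
    fix A assume "A \<in> V"
    then have "?f ?d' A \<in> V" by (intro assms) (use d in auto)
    moreover have "A = ?f d (?f ?d' A)"
      using d by (simp add: vec_eq_iff power_divide)
    ultimately show "A \<in> ?f d ` V" by (rule rev_image_eqI)
  qed (use assms d in auto)
  ultimately show "(\<lambda>A. \<Delta>[d] ** A ** matrix_inv (\<Delta>[d] ** \<Delta>[d] ** \<Delta>[d])) ` V = V"
    by (simp only:)
qed

text \<open>The Jacobian matrix of the transformed map at \<open>x = D^3 y\<close> is the conjugate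
  by \<open>D^3\<close> of the original Jacobian matrix at \<open>y\<close>, so the determinants
  agree.\<close>

lemma diagonal_invariant_druzkowski_matrices: "diagonal_invariant druzkowski_matrices"
proof (rule diagonal_invariantI)
  fix d :: "'n::finite cvec" and A :: "'n cmat"
  assume d: "\<And>i. d $ i \<noteq> 0" and A: "A \<in> druzkowski_matrices"
  let ?J = "\<lambda>A x. mat 1 + \<Delta>[\<chi> i. 3 * ((A *v x) $ i)\<^sup>2] ** A"
  let ?B = "\<chi> i j. d $ i * A $ i $ j / d $ j ^ 3"
  have "det (?J ?B x) = 1" for x
  proof -
    define y where "y = (\<chi> j. x $ j / d $ j ^ 3)"
    let ?D = "\<Delta>[d ^ 3]" and ?E = "\<Delta>[\<chi> i. inverse ((d ^ 3) $ i)]"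
    have d3: "(d ^ 3) $ i = d $ i ^ 3" for i by (simp add: power3_eq_cube)
    then have nz: "(d ^ 3) $ i \<noteq> 0" for i using d by simp
    have DE: "det ?D * det ?E = 1"
      using diag_matrix_inverse(1)[OF nz] by (metis det_I det_mul)
    have "(?B *v x) $ i = d $ i * (A *v y) $ i" for i
      by (simp add: matrix_vector_mult_def y_def sum_distrib_left mult.assoc)
    then have "?J ?B x = ?D ** ?J A y ** ?E"
      using d by (simp add: vec_eq_iff diag_matrix_mult_left diag_matrix_mult_right d3 mat_def)
        (simp add: field_simps power2_eq_square power3_eq_cube)
    then have "det (?J ?B x) = det (?J A y) * (det ?D * det ?E)"
      by (simp add: det_mul)
    then show ?thesis using A DE by (simp add: mem_druzkowski_matrices)
  qed
  then show "?B \<in> druzkowski_matrices" by (simp add: mem_druzkowski_matrices)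
qed

lemma druzkowski_det_indicator:
  assumes A: "A \<in> druzkowski_matrices" and x: "A *v x = indicator_vec K"
  shows "det (mat 1 + \<Delta>[indicator_vec K] ** A) = 1"
proof -
  \<comment> \<open>Evaluating the Jacobian at \<open>c *s x\<close> cancels the factor 3 that comes
    from differentiating the cube.\<close>
  define c where "c = complex_of_real (1 / sqrt 3)"
  have "3 * c\<^sup>2 = 1" by (simp add: c_def power_divide flip: of_real_power)
  then have "(\<chi> i. 3 * ((A *v (c *s x)) $ i)\<^sup>2) = indicator_vec K"
    by (simp add: vector_scalar_commute x vec_eq_iff power_mult_distrib flip: mult.assoc)
      (simp add: indicator_vec_def)
  then show ?thesis using A unfolding mem_druzkowski_matrices by metis
qed

section \<open>Specialization to the vectors \<open>Zvec k\<close>\<close>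

lemma Zvec_eq_indicator_vec: "Zvec k = indicator_vec {i. card {j. j < i} < k}"
  by (simp add: Zvec_def indicator_vec_def)

lemma first_coordinates_nonempty:
  assumes "k > 0"
  shows "{i :: 'n::{finite,linorder}. card {j. j < i} < k} \<noteq> {}"
proof -
  obtain m :: 'n where "\<And>i. m \<le> i"
    using Min_le[OF finite] by blast
  then have "{j. j < m} = {}" by (auto simp: not_less)
  then show ?thesis using assms by (metis (mono_tags) card.empty empty_iff mem_Collect_eq)
qed

lemma Zvec_square: "Zvec k ^ 2 = Zvec k"
  by (simp add: Zvec_def vec_eq_iff power2_eq_square)

text \<open>Common source of all four nonexistence claims: \<open>y\<close> is arbitrary, so vectors
  of the form \<open>A *v y\<close> are included. The equation fits the general one with
  \<open>u = Zvec k ^ 2 + y ^ 2\<close>.\<close>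

lemma generically_no_Zvec_solution:
  fixes V :: "'n::{finite,linorder} cmat set"
  assumes "algebraic_subvariety V" "V \<noteq> {}" "diagonal_invariant V"
  shows "generically V (\<lambda>A. \<forall>k\<in>{3..CARD('n)}. det (mat 1 + \<Delta>[Zvec k] ** A) = 1 \<longrightarrow>
    (\<forall>y. Zvec k + A *v (Zvec k ^ 3 + Zvec k * y ^ 2) \<noteq> 0))"
proof (rule generically_mono[OF generically_no_solution[OF assms]], intro ballI allI impI)
  fix A :: "'n cmat" and k and y :: "'n cvec"
  assume *: "\<forall>K u. K \<noteq> {} \<longrightarrow> det (mat 1 + \<Delta>[indicator_vec K] ** A) = 1 \<longrightarrow>
      indicator_vec K + A *v (indicator_vec K * u) \<noteq> 0"
    and "k \<in> {3..CARD('n)}" and "det (mat 1 + \<Delta>[Zvec k] ** A) = 1"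
  then have "Zvec k + A *v (Zvec k * (Zvec k ^ 2 + y ^ 2)) \<noteq> 0"
    using *[rule_format, OF first_coordinates_nonempty[of k]] unfolding Zvec_eq_indicator_vec by simp
  moreover have "Zvec k ^ 3 + Zvec k * y ^ 2 = Zvec k * (Zvec k ^ 2 + y ^ 2)"
    by (simp add: algebra_simps power2_eq_square power3_eq_cube)
  ultimately show "Zvec k + A *v (Zvec k ^ 3 + Zvec k * y ^ 2) \<noteq> 0" by simp
qed

lemma Zvec_pencil_det:
  assumes "\<forall>s t :: complex. det (mat 1 + \<Delta>[(s *s Zvec k + t *s y) ^ 2] ** A) = 1"
  shows "det (mat 1 + \<Delta>[Zvec k] ** A) = 1"
  using assms[rule_format, of 1 0] by (simp add: Zvec_square)

text \<open>Replaces the pencil condition in the first Druzkowski claim: the equation itself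
  exhibits \<open>Zvec k\<close> as the image of \<open>- x\<close>.\<close>

lemma druzkowski_det_Zvec:
  assumes "A \<in> druzkowski_matrices" "Zvec k + A *v x = 0"
  shows "det (mat 1 + \<Delta>[Zvec k] ** A) = 1"
proof -
  have "A *v (- x) = - (A *v x)"
    by (simp add: matrix_vector_mult_def vec_eq_iff sum_negf)
  moreover have "A *v x = - Zvec k"
    using assms(2) by (simp add: eq_neg_iff_add_eq_0 add.commute)
  ultimately have "A *v (- x) = Zvec k" by simp
  then show ?thesis
    using druzkowski_det_indicator[OF assms(1)] by (simp add: Zvec_eq_indicator_vec)
qed

theorem theorem1p12:
  shows
   "generically (druzkowski_matrices :: 'n::{finite,linorder} cmat set)
      (\<lambda>A.
        \<not> (\<exists>k\<in>{3..CARD('n)}. \<exists>y :: 'n cvec.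
              Zvec k + A *v (Zvec k ^ 3 + Zvec k * (A *v y) ^ 2) = 0) \<and>
        \<not> (\<exists>k\<in>{3..CARD('n)}. \<exists>y :: 'n cvec.
              (\<forall>s t :: complex. det (mat 1 + \<Delta>[(s *s Zvec k + t *s y) ^ 2] ** A) = 1) \<and>
              Zvec k + A *v (Zvec k ^ 3 + Zvec k * y ^ 2) = 0)) \<and>
    (\<forall>V :: 'n cmat set.
      algebraic_subvariety V \<and> V \<noteq> {} \<and> diagonal_invariant V \<longrightarrow>
      generically V
        (\<lambda>A.
          \<not> (\<exists>k\<in>{3..CARD('n)}. \<exists>y :: 'n cvec.
                (\<forall>s t :: complex. det (mat 1 + \<Delta>[(s *s Zvec k + t *s (A *v y)) ^ 2] ** A) = 1) \<and>
                Zvec k + A *v (Zvec k ^ 3 + Zvec k * (A *v y) ^ 2) = 0) \<and>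
          \<not> (\<exists>k\<in>{3..CARD('n)}. \<exists>y :: 'n cvec.
                (\<forall>s t :: complex. det (mat 1 + \<Delta>[(s *s Zvec k + t *s y) ^ 2] ** A) = 1) \<and>
                Zvec k + A *v (Zvec k ^ 3 + Zvec k * y ^ 2) = 0)))"
proof (intro conjI allI impI)
  have "(druzkowski_matrices :: 'n cmat set) \<noteq> {}"
    using zero_mem_druzkowski_matrices by blast
  note generic = generically_no_Zvec_solution[OF algebraic_subvariety_druzkowski_matrices this
      diagonal_invariant_druzkowski_matrices]
  show "generically (druzkowski_matrices :: 'n cmat set)
      (\<lambda>A.
        \<not> (\<exists>k\<in>{3..CARD('n)}. \<exists>y :: 'n cvec.
              Zvec k + A *v (Zvec k ^ 3 + Zvec k * (A *v y) ^ 2) = 0) \<and>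
        \<not> (\<exists>k\<in>{3..CARD('n)}. \<exists>y :: 'n cvec.
              (\<forall>s t :: complex. det (mat 1 + \<Delta>[(s *s Zvec k + t *s y) ^ 2] ** A) = 1) \<and>
              Zvec k + A *v (Zvec k ^ 3 + Zvec k * y ^ 2) = 0))"
    by (rule generically_mono[OF generic]) (use Zvec_pencil_det druzkowski_det_Zvec in blast)
next
  fix V :: "'n cmat set"
  assume "algebraic_subvariety V \<and> V \<noteq> {} \<and> diagonal_invariant V"
  then have generic: "generically V (\<lambda>A. \<forall>k\<in>{3..CARD('n)}. det (mat 1 + \<Delta>[Zvec k] ** A) = 1 \<longrightarrow>
      (\<forall>y. Zvec k + A *v (Zvec k ^ 3 + Zvec k * y ^ 2) \<noteq> 0))"
    using generically_no_Zvec_solution by blast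
  show "generically V
        (\<lambda>A.
          \<not> (\<exists>k\<in>{3..CARD('n)}. \<exists>y :: 'n cvec.
                (\<forall>s t :: complex. det (mat 1 + \<Delta>[(s *s Zvec k + t *s (A *v y)) ^ 2] ** A) = 1) \<and>
                Zvec k + A *v (Zvec k ^ 3 + Zvec k * (A *v y) ^ 2) = 0) \<and>
          \<not> (\<exists>k\<in>{3..CARD('n)}. \<exists>y :: 'n cvec.
                (\<forall>s t :: complex. det (mat 1 + \<Delta>[(s *s Zvec k + t *s y) ^ 2] ** A) = 1) \<and>
                Zvec k + A *v (Zvec k ^ 3 + Zvec k * y ^ 2) = 0))"
    by (rule generically_mono[OF generic]) (use Zvec_pencil_det in blast)
qed

end
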